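(* Let $n\ge 2$ be an integer. There exist a Lipschitz continuous function $f:\mathbb{R}\to\mathbb{R}$, a set $\Omega\subset\mathbb{R}^n$ which is open, bounded, simply connected, different from a ball, and has boundary $\partial\Omega$ globally of class $\mathcal{C}^\infty$, a subset $\Gamma\subset\partial\Omega$ which is nonempty, connected, relatively open in $\partial\Omega$ and included in a sphere of $\mathbb{R}^n$, and a function $u\in\mathcal{C}^2(\mathbb{R}^n\setminus\Omega)$ such that $$\left\{\begin{array}{ll}-\Delta u=f(u) & \text{in }\mathbb{R}^n\setminus\overline{\Omega},\\ |\nabla u|=\frac{1}{2} & \text{on }\partial\Omega,\\ u=1 & \text{on }\Gamma,\\ u\to 0,\ |\nabla u|\to 0 & \text{as }|x|\to\infty.\end{array}\right.$$
   Context: Simply connected sets are understood to be nonempty and connected. A sphere of $\mathbb{R}^n$ is a set $\{x\in\mathbb{R}^n : |x-x_0|=r\}$ with $x_0\in\mathbb{R}^n$, $r>0$. The notation $u\in\mathcal{C}^2(\mathbb{R}^n\setminus\Omega)$ means that $u$ is of class $\mathcal{C}^2$ in the open set $\mathbb{R}^n\setminus\overline{\Omega}$ with $u$ and its derivatives up to order 2 extending continuously to the closed set $\mathbb{R}^n\setminus\Omega$. *)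

theory Defs
  imports "HOL-Analysis.Analysis"
begin

text \<open>
  \<open>Ck_on k S f\<close>: the function \<open>f\<close> is of class \<open>C\<^sup>k\<close> on \<open>S\<close>.  It is only meaningful for open \<open>S\<close>,
  because it uses two-sided derivatives; values of \<open>f\<close> outside \<open>S\<close> play no role.
\<close>
primrec Ck_on :: "nat \<Rightarrow> 'a::euclidean_space set \<Rightarrow> ('a \<Rightarrow> 'b::real_normed_vector) \<Rightarrow> bool" where
  "Ck_on 0 S f \<longleftrightarrow> continuous_on S f"
| "Ck_on (Suc k) S f \<longleftrightarrow>
     (\<forall>x\<in>S. f differentiable (at x)) \<and>
     (\<forall>v. Ck_on k S (\<lambda>x. frechet_derivative f (at x) v))"

definition smooth_on :: "'a::euclidean_space set \<Rightarrow> ('a \<Rightarrow> 'b::real_normed_vector) \<Rightarrow> bool" where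
  "smooth_on S f \<longleftrightarrow> (\<forall>k. Ck_on k S f)"

definition hyperplane_proj :: "'a::euclidean_space \<Rightarrow> 'a \<Rightarrow> 'a" where
  "hyperplane_proj \<nu> x = x - (x \<bullet> \<nu>) *\<^sub>R \<nu>"

text \<open>
  The boundary of \<open>\<Omega>\<close> is globally of class \<open>C\<^sup>\<infinity>\<close>: near each of its points, \<open>\<Omega>\<close> is the
  set strictly above the graph of a \<open>C\<^sup>\<infinity>\<close> function over a hyperplane orthogonal to some unit
  vector \<open>\<nu>\<close>.  To avoid a separate type for the hyperplane, \<open>\<gamma>\<close> is defined on the whole space;
  only its values on the hyperplane are used.  All points of \<open>ball p r\<close> project into
  \<open>ball (hyperplane_proj \<nu> p) r\<close>.
\<close>
definition smooth_boundary :: "'a::euclidean_space set \<Rightarrow> bool" where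
  "smooth_boundary \<Omega> \<longleftrightarrow>
     (\<forall>p\<in>frontier \<Omega>. \<exists>\<nu> r \<gamma>.
        norm \<nu> = 1 \<and> r > 0 \<and>
        smooth_on (ball (hyperplane_proj \<nu> p) r) (\<gamma> :: 'a \<Rightarrow> real) \<and>
        \<Omega> \<inter> ball p r = {x \<in> ball p r. x \<bullet> \<nu> > \<gamma> (hyperplane_proj \<nu> x)})"

text \<open>
  \<open>C2_outside \<Omega> u Du D2u\<close>: the function \<open>u\<close> is of class \<open>C\<^sup>2\<close> on the closed set \<open>- \<Omega>\<close> in the sense
  that it is \<open>C\<^sup>2\<close> in the open set \<open>- closure \<Omega>\<close>, with gradient \<open>Du\<close> and Hessian matrix \<open>D2u\<close> there,
  and \<open>u\<close>, \<open>Du\<close>, \<open>D2u\<close> are continuous up to the boundary.  On \<open>frontier \<Omega>\<close> the three functions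
  thus denote the continuous extensions from \<open>- closure \<Omega>\<close>, which are unique when
  \<open>smooth_boundary \<Omega>\<close> holds, since then each point of \<open>frontier \<Omega>\<close> is a limit of points of
  \<open>- closure \<Omega>\<close>.
\<close>
definition C2_outside ::
  "(real^'n) set \<Rightarrow> (real^'n \<Rightarrow> real) \<Rightarrow> (real^'n \<Rightarrow> real^'n) \<Rightarrow> (real^'n \<Rightarrow> real^'n^'n) \<Rightarrow> bool" where
  "C2_outside \<Omega> u Du D2u \<longleftrightarrow>
     continuous_on (- \<Omega>) u \<and> continuous_on (- \<Omega>) Du \<and> continuous_on (- \<Omega>) D2u \<and>
     (\<forall>x \<in> - closure \<Omega>. GDERIV u x :> Du x \<and> (Du has_derivative (\<lambda>h. D2u x *v h)) (at x))"

end

theory Submission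
  imports Defs
begin

text \<open>
  The solution is radial, \<open>u x = \<phi> (norm x)\<close>, where \<open>\<phi> r = (3 - r) / 2\<close> is affine with slope
  \<open>-1/2\<close> on \<open>[1, 2]\<close> and continues as a decreasing, exponentially decaying function. Hence the
  gradient has norm \<open>1/2\<close> on the whole annulus \<open>1 \<le> norm x \<le> 2\<close>, and any domain with smooth
  boundary in this annulus is admissible; we take the unit ball with a small smooth bump, and let
  \<open>\<Gamma>\<close> be an unperturbed half of the unit sphere. Since \<open>\<phi>\<close> is strictly decreasing, the Laplacian
  of \<open>u\<close> is a function of \<open>u\<close>, which is Lipschitz because its radial derivative is dominated by
  \<open>- \<phi>'\<close>.
\<close>

section \<open>Calculus of \<open>C\<^sup>k\<close> functions\<close>

lemma Ck_on_cong:
  assumes "open S" "Ck_on k S f" "\<And>x. x \<in> S \<Longrightarrow> f x = g x"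
  shows "Ck_on k S g"
  using assms(2,3)
proof (induction k arbitrary: f g)
  case 0
  then show ?case by (auto intro: continuous_on_eq)
next
  case (Suc k)
  have diff: "f differentiable at x" if "x \<in> S" for x
    using Suc.prems that by simp
  have "g differentiable at x" if x: "x \<in> S" for x
    using diff[OF x] has_derivative_transform_within_open[OF _ \<open>open S\<close> x] Suc.prems(2)
    unfolding differentiable_def by blast
  moreover have "Ck_on k S (\<lambda>x. frechet_derivative g (at x) v)" for v
  proof (rule Suc.IH)
    show "Ck_on k S (\<lambda>x. frechet_derivative f (at x) v)"
      using Suc.prems by simp
    show "frechet_derivative f (at x) v = frechet_derivative g (at x) v" if "x \<in> S" for x
      using frechet_derivative_transform_within_open[OF diff \<open>open S\<close> that, of g] Suc.prems(2) that
      by simp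
  qed
  ultimately show ?case by simp
qed

lemma Ck_on_subset: "Ck_on k S f \<Longrightarrow> T \<subseteq> S \<Longrightarrow> Ck_on k T f"
  by (induction k arbitrary: f) (auto intro: continuous_on_subset)

text \<open>Derivatives are unique, so any explicit family \<open>f'\<close> may stand in for
  \<open>frechet_derivative\<close>. The regularity proofs below are inductions through this
  rule.\<close>

lemma Ck_on_SucI:
  assumes "open S" "\<And>x. x \<in> S \<Longrightarrow> (f has_derivative f' x) (at x)"
    and "\<And>v. Ck_on k S (\<lambda>x. f' x v)"
  shows "Ck_on (Suc k) S f"
proof -
  have "Ck_on k S (\<lambda>x. frechet_derivative f (at x) v)" for v
    by (rule Ck_on_cong[OF assms(1) assms(3)[of v]]) (use assms(2) frechet_derivative_at in metis)
  then show ?thesis using assms(2) by (auto simp: differentiable_def)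
qed

lemma Ck_on_SucE:
  assumes "Ck_on (Suc k) S f"
  obtains f' where "\<And>x. x \<in> S \<Longrightarrow> (f has_derivative f' x) (at x)"
    and "\<And>v. Ck_on k S (\<lambda>x. f' x v)"
  using assms that[of "\<lambda>x. frechet_derivative f (at x)"]
  by (simp add: frechet_derivative_works)

lemma Ck_on_Suc_imp: "Ck_on (Suc k) S f \<Longrightarrow> Ck_on k S f"
proof (induction k arbitrary: f)
  case 0
  then show ?case
    by (auto intro!: continuous_at_imp_continuous_on differentiable_imp_continuous_within)
next
  case (Suc k)
  then show ?case by (metis Ck_on.simps(2))
qed

lemma Ck_on_const: "open S \<Longrightarrow> Ck_on k S (\<lambda>x. c)"
proof (induction k arbitrary: c)
  case (Suc k)
  show ?case
    by (rule Ck_on_SucI[where f' = "\<lambda>x v. 0"]) (use Suc in auto)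
qed auto

lemma Ck_on_bounded_linear:
  assumes "open S" "bounded_linear f"
  shows "Ck_on k S f"
proof (cases k)
  case 0
  then show ?thesis using assms by (simp add: linear_continuous_on)
next
  case (Suc m)
  show ?thesis unfolding Suc
    by (rule Ck_on_SucI[OF assms(1), where f' = "\<lambda>x. f"])
      (use assms in \<open>auto intro: Ck_on_const bounded_linear_imp_has_derivative\<close>)
qed

lemma Ck_on_add:
  assumes "open S" "Ck_on k S f" "Ck_on k S g"
  shows "Ck_on k S (\<lambda>x. f x + g x)"
  using assms(2,3)
proof (induction k arbitrary: f g)
  case 0
  then show ?case by (auto intro: continuous_intros)
next
  case (Suc k)
  from Suc.prems(1) obtain f' where f':
    "\<And>x. x \<in> S \<Longrightarrow> (f has_derivative f' x) (at x)" "\<And>v. Ck_on k S (\<lambda>x. f' x v)"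
    by (rule Ck_on_SucE) blast
  from Suc.prems(2) obtain g' where g':
    "\<And>x. x \<in> S \<Longrightarrow> (g has_derivative g' x) (at x)" "\<And>v. Ck_on k S (\<lambda>x. g' x v)"
    by (rule Ck_on_SucE) blast
  show ?case
    by (rule Ck_on_SucI[OF assms(1), where f' = "\<lambda>x v. f' x v + g' x v"])
      (auto intro: has_derivative_add f' g' Suc.IH)
qed

lemma Ck_on_mult:
  fixes f g :: "'a::euclidean_space \<Rightarrow> real"
  assumes "open S" "Ck_on k S f" "Ck_on k S g"
  shows "Ck_on k S (\<lambda>x. f x * g x)"
  using assms(2,3)
proof (induction k arbitrary: f g)
  case 0
  then show ?case by (auto intro: continuous_intros)
next
  case (Suc k)
  from Suc.prems(1) obtain f' where f':
    "\<And>x. x \<in> S \<Longrightarrow> (f has_derivative f' x) (at x)" "\<And>v. Ck_on k S (\<lambda>x. f' x v)"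
    by (rule Ck_on_SucE) blast
  from Suc.prems(2) obtain g' where g':
    "\<And>x. x \<in> S \<Longrightarrow> (g has_derivative g' x) (at x)" "\<And>v. Ck_on k S (\<lambda>x. g' x v)"
    by (rule Ck_on_SucE) blast
  \<comment> \<open>The product rule keeps one factor undifferentiated, and the induction hypothesis
    needs that factor at level \<open>k\<close>.\<close>
  note [intro] = Suc.prems[THEN Ck_on_Suc_imp]
  show ?case
    by (rule Ck_on_SucI[OF assms(1), where f' = "\<lambda>x v. f x * g' x v + f' x v * g x"])
      (auto intro!: has_derivative_mult f' g' Suc.IH Ck_on_add assms(1))
qed

text \<open>By the chain rule the derivative is a product of \<open>f' x v\<close> and
  \<open>g' (f x) 1\<close>. The second factor is again a composition, one order lower, so the
  induction closes.\<close>

lemma Ck_on_compose: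
  fixes g :: "real \<Rightarrow> real" and f :: "'a::euclidean_space \<Rightarrow> real"
  assumes "open S" "Ck_on k T g" "Ck_on k S f" "f ` S \<subseteq> T"
  shows "Ck_on k S (\<lambda>x. g (f x))"
  using assms(2-4)
proof (induction k arbitrary: f g)
  case 0
  then show ?case by (auto intro: continuous_on_compose2)
next
  case (Suc k)
  from Suc.prems(1) obtain g' where g':
    "\<And>x. x \<in> T \<Longrightarrow> (g has_derivative g' x) (at x)" "\<And>v. Ck_on k T (\<lambda>x. g' x v)"
    by (rule Ck_on_SucE) blast
  from Suc.prems(2) obtain f' where f':
    "\<And>x. x \<in> S \<Longrightarrow> (f has_derivative f' x) (at x)" "\<And>v. Ck_on k S (\<lambda>x. f' x v)"
    by (rule Ck_on_SucE) blast
  have lin: "g' t v = v * g' t 1" if "t \<in> T" for t v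
    using linear_cmul[OF has_derivative_linear[OF g'(1)[OF that]], of v 1] by simp
  show ?case
  proof (rule Ck_on_SucI[OF assms(1), where f' = "\<lambda>x v. f' x v * g' (f x) 1"])
    show "((\<lambda>x. g (f x)) has_derivative (\<lambda>v. f' x v * g' (f x) 1)) (at x)" if "x \<in> S" for x
    proof -
      have "f x \<in> T" using that Suc.prems(3) by auto
      then show ?thesis
        by (intro has_derivative_eq_rhs[OF has_derivative_compose[OF f'(1)[OF that] g'(1)]] ext lin)
    qed
    show "Ck_on k S (\<lambda>x. f' x v * g' (f x) 1)" for v
      by (rule Ck_on_mult[OF assms(1) f'(2)])
        (rule Suc.IH[OF g'(2) Ck_on_Suc_imp[OF Suc.prems(2)] Suc.prems(3)])
  qed
qed

lemma Ck_on_SucI_real: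
  fixes f :: "real \<Rightarrow> real"
  assumes "open S" "\<And>x. x \<in> S \<Longrightarrow> (f has_real_derivative f' x) (at x)" "Ck_on k S f'"
  shows "Ck_on (Suc k) S f"
  by (rule Ck_on_SucI[OF assms(1), where f' = "\<lambda>x v. f' x * v"])
    (use assms in \<open>auto intro!: Ck_on_mult Ck_on_const simp: has_field_derivative_def\<close>)

text \<open>The exponent is generalized in the induction because each derivative lowers it by 1. The
  case 1/2 supplies the square root in the boundary graphs.\<close>

lemma smooth_on_powr: "smooth_on {0<..} (\<lambda>t::real. t powr a)"
proof -
  have "Ck_on k {0<..} (\<lambda>t::real. t powr a)" for k
  proof (induction k arbitrary: a)
    case 0
    then show ?case by (auto intro!: continuous_intros)
  next
    case (Suc k)
    show ?case
    proof (rule Ck_on_SucI_real)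
      show "((\<lambda>t. t powr a) has_real_derivative a * t powr (a - 1)) (at t)" if "t \<in> {0<..}" for t
        using that by (intro has_real_derivative_powr) simp
      show "Ck_on k {0<..} (\<lambda>t::real. a * t powr (a - 1))"
        by (intro Ck_on_mult[OF _ Ck_on_const Suc] open_greaterThan)
    qed simp
  qed
  then show ?thesis by (simp add: smooth_on_def)
qed

section \<open>A smooth bump function\<close>

text \<open>The case \<open>k = 0\<close> is the classical function \<open>exp (- 1 / s)\<close>
  extended by 0. The powers of \<open>1 / s\<close> make the span of the family closed under
  differentiation.\<close>

definition flat :: "nat \<Rightarrow> real \<Rightarrow> real" where
  "flat k s = (if s \<le> 0 then 0 else (1 / s) ^ k * exp (- (1 / s)))"

text \<open>Away from 0 this is the product rule. At 0 the right difference quotient is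
  \<open>(1 / h) ^ Suc k * exp (- 1 / h)\<close>, which tends to 0 because the exponential beats
  every power.\<close>

lemma flat_deriv:
  "(flat k has_real_derivative - real k * flat (Suc k) s + flat (Suc (Suc k)) s) (at s)"
proof -
  consider "s < 0" | "s = 0" | "s > 0" by linarith
  then show ?thesis
  proof cases
    case 1
    have "((\<lambda>_. 0) has_real_derivative 0) (at s)" by simp
    then have "(flat k has_real_derivative 0) (at s)"
      by (rule DERIV_cong_ev[THEN iffD1, rotated 3, OF _ refl _ refl])
        (use 1 eventually_nhds_in_open[of "{..<0}" s] in \<open>auto simp: flat_def elim!: eventually_mono\<close>)
    then show ?thesis using 1 by (simp add: flat_def)
  next
    case 3
    have "((\<lambda>s. (1 / s) ^ k * exp (- (1 / s))) has_real_derivative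
        - real k * (1 / s) ^ Suc k * exp (- (1 / s)) + (1 / s) ^ Suc (Suc k) * exp (- (1 / s))) (at s)"
      using 3 by (cases k) (auto intro!: derivative_eq_intros simp: field_simps, metis One_nat_def power_eq_if)
    then have "(flat k has_real_derivative
        - real k * (1 / s) ^ Suc k * exp (- (1 / s)) + (1 / s) ^ Suc (Suc k) * exp (- (1 / s))) (at s)"
      by (rule DERIV_cong_ev[THEN iffD1, rotated 3, OF _ refl _ refl])
        (use 3 eventually_nhds_in_open[of "{0<..}" s] in \<open>auto simp: flat_def elim!: eventually_mono\<close>)
    then show ?thesis using 3 by (simp add: flat_def mult.assoc)
  next
    case 2
    have "((\<lambda>h. flat k h / h) \<longlongrightarrow> 0) (at_left 0)"
      by (rule tendsto_eventually) (auto simp: flat_def eventually_at_filter)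
    moreover have "((\<lambda>h. flat k h / h) \<longlongrightarrow> 0) (at_right 0)"
    proof -
      have "((\<lambda>h::real. (1 / h) ^ Suc k / exp (1 / h)) \<longlongrightarrow> 0) (at_right 0)"
        using filterlim_compose[OF tendsto_power_div_exp_0[of "Suc k"] filterlim_inverse_at_top_right]
        unfolding inverse_eq_divide .
      then show ?thesis
        by (rule Lim_transform_eventually)
          (auto simp: flat_def eventually_at_filter exp_minus field_simps)
    qed
    ultimately have "((\<lambda>h. flat k h / h) \<longlongrightarrow> 0) (at 0)"
      by (simp add: filterlim_split_at)
    then have "(flat k has_real_derivative 0) (at 0)"
      by (simp add: DERIV_def flat_def)
    then show ?thesis using 2 by (simp add: flat_def)
  qed
qed

lemma smooth_on_flat: "smooth_on UNIV (flat k)"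
proof -
  have "Ck_on m UNIV (flat k)" for m
  proof (induction m arbitrary: k)
    case 0
    show ?case
      using flat_deriv by (auto intro!: continuous_at_imp_continuous_on DERIV_isCont)
  next
    case (Suc m)
    show ?case
      by (rule Ck_on_SucI_real[OF _ flat_deriv])
        (intro open_UNIV Ck_on_add Ck_on_mult[of _ _ "\<lambda>_. - real k"] Ck_on_const Suc)+
  qed
  then show ?thesis by (simp add: smooth_on_def)
qed

text \<open>A continuous derivative vanishing off a compact interval is bounded, and a bounded
  derivative gives a Lipschitz constant.\<close>

lemma lipschitz_on_compact_support:
  fixes b :: "real \<Rightarrow> real"
  assumes b': "\<And>t. (b has_real_derivative b' t) (at t)" and "continuous_on {x..y} b'"
    and supp: "\<And>t. t \<notin> {x..y} \<Longrightarrow> b' t = 0"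
  obtains C where "C \<ge> 0" "C-lipschitz_on UNIV b"
proof -
  have "bounded (b' ` {x..y})"
    using assms(2) by (intro compact_imp_bounded compact_continuous_image) auto
  then obtain C where C: "C > 0" "\<And>t. t \<in> {x..y} \<Longrightarrow> \<bar>b' t\<bar> \<le> C"
    by (auto simp: bounded_pos)
  then have bound: "\<bar>b' t\<bar> \<le> C" for t using supp[of t] by (cases "t \<in> {x..y}") auto
  have "C-lipschitz_on UNIV b"
  proof (rule bounded_derivative_imp_lipschitz)
    show "(b has_derivative (*) (b' t)) (at t within UNIV)" for t
      using b' by (simp add: has_field_derivative_def)
    show "onorm ((*) (b' t)) \<le> C" for t
      using bound[of t] C(1)
      by (intro onorm_bound) (auto simp: abs_mult intro: mult_right_mono)
  qed (use C in auto)
  with C that show ?thesis by (meson less_imp_le)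
qed

text \<open>The product of a flat function rising at 0 and its mirror image falling to 0 at 1/2,
  scaled down to have Lipschitz constant 1.\<close>

lemma bump_exists:
  obtains \<beta> :: "real \<Rightarrow> real" where "smooth_on UNIV \<beta>" "\<And>t. 0 \<le> \<beta> t"
    "\<And>t. t \<le> 0 \<or> 1/2 \<le> t \<Longrightarrow> \<beta> t = 0" "\<And>t. 0 < t \<Longrightarrow> t < 1/2 \<Longrightarrow> 0 < \<beta> t"
    "1-lipschitz_on UNIV \<beta>"
proof -
  define b where "b t = flat 0 t * flat 0 (1/2 + (-1) * t)" for t
  define b' where "b' t = - flat 0 t * flat 2 (1/2 + (-1) * t) + flat 2 t * flat 0 (1/2 + (-1) * t)" for t
  have sm: "Ck_on k UNIV b" for k
  proof -
    have flat: "Ck_on k UNIV (flat 0)" using smooth_on_flat by (simp add: smooth_on_def)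
    have "Ck_on k UNIV (\<lambda>t::real. 1/2 + (-1) * t)"
      by (intro open_UNIV Ck_on_add Ck_on_const Ck_on_bounded_linear bounded_linear_mult_right)
    then have "Ck_on k UNIV (\<lambda>t. flat 0 (1/2 + (-1) * t))"
      by (rule Ck_on_compose[OF open_UNIV flat]) simp
    then show ?thesis unfolding b_def[abs_def] by (rule Ck_on_mult[OF open_UNIV flat])
  qed
  have deriv: "(b has_real_derivative b' t) (at t)" for t
  proof -
    have f0: "(flat 0 has_real_derivative flat 2 s) (at s)" for s
      using flat_deriv[of 0 s] by (simp add: numeral_2_eq_2)
    have "((\<lambda>t. flat 0 (1/2 + (-1) * t)) has_real_derivative flat 2 (1/2 + (-1) * t) * (-1)) (at t)"
      by (rule DERIV_chain2[OF f0]) (auto intro!: derivative_eq_intros)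
    from DERIV_mult[OF f0 this] show ?thesis
      unfolding b_def[abs_def] b'_def by (simp add: algebra_simps)
  qed
  have flat_cont: "isCont (flat k) s" for k s
    using flat_deriv by (rule DERIV_isCont)
  have "continuous_on {0..1/2} b'"
    unfolding b'_def
    by (intro continuous_at_imp_continuous_on ballI continuous_intros
        isCont_o2[where g = "flat _" and f = "\<lambda>t. 1/2 + (-1) * t"] flat_cont)
  moreover have "b' t = 0" if "t \<notin> {0..1/2}" for t
    using that by (auto simp: b'_def flat_def)
  ultimately obtain C where C: "C \<ge> 0" "C-lipschitz_on UNIV b"
    using lipschitz_on_compact_support[OF deriv] by metis
  \<comment> \<open>Adding 1 keeps the denominator positive when \<open>C = 0\<close>.\<close>
  define c where "c = 1 / (C + 1)"
  have c: "c > 0" "c * C \<le> 1" using C(1) by (auto simp: c_def field_simps)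
  show ?thesis
  proof (rule that[of "\<lambda>t. c * b t"])
    show "smooth_on UNIV (\<lambda>t. c * b t)"
      unfolding smooth_on_def by (auto intro!: Ck_on_mult Ck_on_const sm)
    show "1-lipschitz_on UNIV (\<lambda>t. c * b t)"
      using lipschitz_on_cmult_real[OF C(2), of c] c by (auto elim: lipschitz_on_le)
  qed (use c in \<open>auto simp: b_def flat_def\<close>)
qed

section \<open>The perturbed ball\<close>

text \<open>The Lipschitz constant 1 serves twice: it bounds the height of the bump and it makes the
  domain star-shaped. Strict positivity inside the support is what distinguishes the domain from a
  ball.\<close>

locale bumped_ball =
  fixes \<beta> :: "real \<Rightarrow> real" and e :: "'a::euclidean_space"
  assumes e: "e \<in> Basis" and smooth: "smooth_on UNIV \<beta>" and nonneg: "0 \<le> \<beta> t"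
    and zero: "t \<le> 0 \<or> 1/2 \<le> t \<Longrightarrow> \<beta> t = 0" and pos: "0 < t \<Longrightarrow> t < 1/2 \<Longrightarrow> 0 < \<beta> t"
    and lip: "1-lipschitz_on UNIV \<beta>"
begin

text \<open>The norm is squared so that it splits orthogonally into a coordinate and a projection,
  which yields explicit boundary graphs.\<close>

definition \<Omega> :: "'a set" where
  "\<Omega> = {x. (norm x)\<^sup>2 < 1 + \<beta> (x \<bullet> e)}"

lemma lip_real: "\<bar>\<beta> s - \<beta> t\<bar> \<le> \<bar>s - t\<bar>"
  using lipschitz_onD[OF lip, of s t] by (simp add: dist_real_def)

lemma bump_le: "\<beta> t \<le> 1/2"
proof (cases "0 < t \<and> t < 1/2")
  case True
  then show ?thesis using lip_real[of t 0] zero[of 0] by (simp add: nonneg)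
next
  case False
  then show ?thesis using zero[of t] by auto
qed

lemma continuous_bump: "continuous_on UNIV (\<lambda>x. \<beta> (x \<bullet> e))"
  by (rule continuous_on_compose2[OF lipschitz_on_continuous_on[OF lip]])
    (auto intro: continuous_intros)

lemma open_domain: "open \<Omega>"
  unfolding \<Omega>_def by (intro open_Collect_less continuous_intros continuous_bump)

lemma ball_subset_domain: "ball 0 1 \<subseteq> \<Omega>"
proof
  fix x :: 'a assume "x \<in> ball 0 1"
  then have "(norm x)\<^sup>2 < 1" by (simp add: power_less_one_iff)
  then show "x \<in> \<Omega>" using nonneg[of "x \<bullet> e"] by (simp add: \<Omega>_def)
qed

lemma bounded_domain: "bounded \<Omega>"
proof (rule bounded_subset[OF bounded_ball])
  show "\<Omega> \<subseteq> ball 0 2"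
  proof
    fix x assume "x \<in> \<Omega>"
    then have "(norm x)\<^sup>2 < 2\<^sup>2" using bump_le[of "x \<bullet> e"] by (simp add: \<Omega>_def)
    then show "x \<in> ball 0 2" using power2_less_imp_less[of "norm x" 2] by simp
  qed
qed

text \<open>One inequality passes to the closure by continuity; the other holds because an open set
  misses its frontier.\<close>

lemma frontier_domainD:
  assumes "x \<in> frontier \<Omega>"
  shows "(norm x)\<^sup>2 = 1 + \<beta> (x \<bullet> e)"
proof -
  have "closed {x. (norm x)\<^sup>2 \<le> 1 + \<beta> (x \<bullet> e)}"
    by (intro closed_Collect_le continuous_intros continuous_bump)
  then have "closure \<Omega> \<subseteq> {x. (norm x)\<^sup>2 \<le> 1 + \<beta> (x \<bullet> e)}"
    by (rule closure_minimal[rotated]) (auto simp: \<Omega>_def)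
  with assms open_domain show ?thesis
    by (auto simp: frontier_def interior_open) (force simp: \<Omega>_def)
qed

text \<open>Places the boundary in the annulus where the profile has constant slope -1/2.\<close>

lemma norm_frontier_domain:
  assumes "x \<in> frontier \<Omega>"
  shows "1 \<le> norm x" "norm x \<le> 2"
proof -
  have "1 \<le> (norm x)\<^sup>2" "(norm x)\<^sup>2 \<le> 2\<^sup>2"
    using frontier_domainD[OF assms] nonneg[of "x \<bullet> e"] bump_le[of "x \<bullet> e"] by auto
  then show "1 \<le> norm x" "norm x \<le> 2"
    using power2_le_imp_le[of 1 "norm x"] power2_le_imp_le[of "norm x" 2] by auto
qed

lemma norm_ge_outside_domain:
  assumes "x \<notin> \<Omega>"
  shows "1 \<le> norm x"
  using assms ball_subset_domain by (meson mem_ball_0 not_le subsetD)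

text \<open>Where the bump vanishes, a unit vector lies outside the domain but is a limit of points
  of the unit ball.\<close>

lemma unit_in_frontier:
  assumes "norm x = 1" "x \<bullet> e \<le> 0 \<or> 1/2 \<le> x \<bullet> e"
  shows "x \<in> frontier \<Omega>"
proof -
  have "x \<notin> \<Omega>" using assms zero[of "x \<bullet> e"] by (simp add: \<Omega>_def)
  moreover have "x \<in> closure \<Omega>"
    using closure_mono[OF ball_subset_domain] assms(1) by auto
  ultimately show ?thesis using open_domain by (simp add: frontier_def interior_open)
qed

text \<open>Shrinking \<open>x\<close> to \<open>t *\<^sub>R x\<close> changes the bump by at most
  \<open>(1 - t) * norm x\<close> and lowers the squared norm by
  \<open>(1 - t) * (1 + t) * (norm x)\<^sup>2\<close>. The gain wins when
  \<open>norm x \<ge> 1\<close>; otherwise the segment stays in the unit ball. Connectedness and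
  simple connectedness both follow.\<close>

lemma starlike_domain: "starlike \<Omega>"
  unfolding starlike_def
proof (intro bexI ballI subsetI)
  show "0 \<in> \<Omega>" using ball_subset_domain by auto
  fix x y assume x: "x \<in> \<Omega>" and "y \<in> closed_segment 0 x"
  then obtain t where t: "0 \<le> t" "t \<le> 1" "y = t *\<^sub>R x"
    by (auto simp: closed_segment_def)
  show "y \<in> \<Omega>"
  proof (cases "norm x < 1")
    case True
    then have "norm y < 1"
      using t mult_left_le_one_le[of "norm x" t] by auto
    then show ?thesis using ball_subset_domain by auto
  next
    case False
    then have n: "norm x \<le> (norm x)\<^sup>2" by (simp add: self_le_power)
    have "\<beta> (x \<bullet> e) - \<beta> (y \<bullet> e) \<le> \<bar>x \<bullet> e - y \<bullet> e\<bar>"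
      using lip_real[of "x \<bullet> e" "y \<bullet> e"] by linarith
    also have "x \<bullet> e - y \<bullet> e = (1 - t) * (x \<bullet> e)"
      using t(3) by (simp add: algebra_simps)
    also have "\<bar>\<dots>\<bar> = (1 - t) * \<bar>x \<bullet> e\<bar>"
      using t by (simp add: abs_mult)
    also have "\<dots> \<le> (1 - t) * (norm x)\<^sup>2"
      using t Basis_le_norm[OF e, of x] n by (intro mult_left_mono) auto
    also have "\<dots> \<le> (1 - t) * (1 + t) * (norm x)\<^sup>2"
      using t mult_left_mono[of 1 "1 + t" "1 - t"] by (intro mult_right_mono) auto
    also have "\<dots> = (norm x)\<^sup>2 - (norm y)\<^sup>2"
      using t by (simp add: power_mult_distrib algebra_simps power2_eq_square)
    finally show ?thesis using x by (simp add: \<Omega>_def)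
  qed
qed

text \<open>Where the condition \<open>x \<in> \<Omega>\<close> involves \<open>x\<close> only through \<open>norm x\<close> and its projection along
  \<open>\<nu>\<close>, it is a quadratic inequality for \<open>x \<bullet> \<nu>\<close>, solved by a square root.\<close>

lemma smooth_graph:
  fixes p \<nu> :: 'a and b :: "'a \<Rightarrow> real"
  assumes \<nu>: "norm \<nu> = 1" and p: "p \<bullet> \<nu> < 0" and b: "smooth_on UNIV b"
    and "r > 0"
    and \<Omega>: "\<And>x. x \<in> ball p r \<Longrightarrow> x \<in> \<Omega> \<longleftrightarrow> (norm x)\<^sup>2 < 1 + b (hyperplane_proj \<nu> x)"
    and norm_p: "(norm p)\<^sup>2 = 1 + b (hyperplane_proj \<nu> p)"
  shows "\<exists>\<nu> r \<gamma>. norm \<nu> = 1 \<and> r > 0 \<and>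
           smooth_on (ball (hyperplane_proj \<nu> p) r) (\<gamma> :: 'a \<Rightarrow> real) \<and>
           \<Omega> \<inter> ball p r = {x \<in> ball p r. x \<bullet> \<nu> > \<gamma> (hyperplane_proj \<nu> x)}"
proof -
  \<comment> \<open>On the boundary near \<open>p\<close>, \<open>Q\<close> of the projection equals
    the square of the remaining coordinate \<open>x \<bullet> \<nu>\<close>.\<close>
  define Q where "Q y = 1 + b y + (-1) * (y \<bullet> y)" for y
  have split: "(norm x)\<^sup>2 = (x \<bullet> \<nu>)\<^sup>2 + hyperplane_proj \<nu> x \<bullet> hyperplane_proj \<nu> x" for x
    using \<nu> by (simp add: hyperplane_proj_def power2_norm_eq_inner norm_eq_1 algebra_simps
        inner_commute power2_eq_square[of "x \<bullet> \<nu>"]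
        power2_eq_square[of "\<nu> \<bullet> x"])
  have "Ck_on k UNIV Q" for k
  proof -
    have coord: "Ck_on k UNIV (\<lambda>y::'a. y \<bullet> i)" for i
      by (rule Ck_on_bounded_linear[OF open_UNIV bounded_linear_inner_left])
    have "Ck_on k UNIV (\<lambda>y::'a. \<Sum>i\<in>B. (y \<bullet> i) * (y \<bullet> i))" if "finite B" for B
      using that
    proof induction
      case empty
      then show ?case by (simp add: Ck_on_const)
    next
      case (insert i B)
      then show ?case
        using Ck_on_add[OF open_UNIV Ck_on_mult[OF open_UNIV coord coord]] by simp
    qed
    then have "Ck_on k UNIV (\<lambda>y::'a. y \<bullet> y)"
      by (simp only: euclidean_inner[of y y for y] finite_Basis)
    then have "Ck_on k UNIV (\<lambda>y::'a. (-1) * (y \<bullet> y))"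
      by (rule Ck_on_mult[OF open_UNIV Ck_on_const[OF open_UNIV]])
    moreover have "Ck_on k UNIV b" using b by (simp add: smooth_on_def)
    ultimately show ?thesis
      unfolding Q_def[abs_def] by (intro Ck_on_add[OF open_UNIV] Ck_on_const open_UNIV)
  qed
  note Q_smooth = this
  have "open {y. Q y > 0}"
    using Q_smooth[of 0] by (intro open_Collect_less) auto
  moreover have "Q (hyperplane_proj \<nu> p) > 0"
  proof -
    have "0 < (p \<bullet> \<nu>)\<^sup>2" using p by simp
    then show ?thesis unfolding Q_def using norm_p split[of p] by linarith
  qed
  ultimately obtain r1 where r1: "r1 > 0" "ball (hyperplane_proj \<nu> p) r1 \<subseteq> {y. Q y > 0}"
    using openE[of "{y. Q y > 0}" "hyperplane_proj \<nu> p"] by blast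
  \<comment> \<open>The three bounds keep, in turn, the local description of the domain, the
    positivity of \<open>Q\<close>, and the negative sign of
    \<open>x \<bullet> \<nu>\<close>.\<close>
  define r' where "r' = min r (min r1 (- (p \<bullet> \<nu>)))"
  \<comment> \<open>The negative root is the right branch since
    \<open>p \<bullet> \<nu> < 0\<close>.\<close>
  define \<gamma> where "\<gamma> y = (-1) * Q y powr (1/2)" for y
  have r': "r' > 0" using r1 p \<open>r > 0\<close> by (simp add: r'_def)
  have "Ck_on k (ball (hyperplane_proj \<nu> p) r') \<gamma>" for k
  proof -
    have "Ck_on k (ball (hyperplane_proj \<nu> p) r') (\<lambda>y. Q y powr (1/2))"
    proof (rule Ck_on_compose[OF open_ball, where g = "\<lambda>t. t powr (1/2)" and T = "{0<..}"])
      show "Ck_on k {0<..} (\<lambda>t::real. t powr (1/2))"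
        using smooth_on_powr by (simp add: smooth_on_def)
      show "Ck_on k (ball (hyperplane_proj \<nu> p) r') Q"
        using Q_smooth by (rule Ck_on_subset) simp
      show "Q ` ball (hyperplane_proj \<nu> p) r' \<subseteq> {0<..}"
        using r1(2) by (fastforce simp: r'_def)
    qed
    then show ?thesis
      unfolding \<gamma>_def[abs_def] by (rule Ck_on_mult[OF open_ball Ck_on_const[OF open_ball]])
  qed
  then have "smooth_on (ball (hyperplane_proj \<nu> p) r') \<gamma>" by (simp add: smooth_on_def)
  moreover have "x \<in> \<Omega> \<longleftrightarrow> x \<bullet> \<nu> > \<gamma> (hyperplane_proj \<nu> x)" if x: "x \<in> ball p r'" for x
  proof -
    have "\<bar>(p - x) \<bullet> \<nu>\<bar> \<le> norm (p - x)"
      using Cauchy_Schwarz_ineq2[of "p - x" \<nu>] \<nu> by simp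
    moreover have "norm (p - x) < - (p \<bullet> \<nu>)" using x by (simp add: r'_def dist_norm)
    ultimately have neg: "x \<bullet> \<nu> < 0" unfolding inner_diff_left by linarith
    \<comment> \<open>Orthogonal projection does not increase distances, so the projection of
      \<open>x\<close> stays where \<open>Q\<close> is positive.\<close>
    have "dist (hyperplane_proj \<nu> p) (hyperplane_proj \<nu> x) \<le> dist p x"
    proof -
      have "hyperplane_proj \<nu> p - hyperplane_proj \<nu> x = hyperplane_proj \<nu> (p - x)"
        by (simp add: hyperplane_proj_def algebra_simps)
      moreover have "(norm (hyperplane_proj \<nu> (p - x)))\<^sup>2 \<le> (norm (p - x))\<^sup>2"
        using split[of "p - x"] by (simp add: power2_norm_eq_inner)
      ultimately show ?thesis by (simp add: dist_norm)
    qed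
    then have Q: "Q (hyperplane_proj \<nu> x) > 0"
      using x r1(2) by (auto simp: r'_def subset_iff)
    have "x \<in> \<Omega> \<longleftrightarrow> (x \<bullet> \<nu>)\<^sup>2 < Q (hyperplane_proj \<nu> x)"
      using \<Omega>[of x] x split[of x] by (auto simp: r'_def Q_def)
    also have "\<dots> \<longleftrightarrow> - (x \<bullet> \<nu>) < sqrt (Q (hyperplane_proj \<nu> x))"
      using neg real_sqrt_less_iff[of "(x \<bullet> \<nu>)\<^sup>2"] by simp
    also have "sqrt (Q (hyperplane_proj \<nu> x)) = - \<gamma> (hyperplane_proj \<nu> x)"
      using Q by (simp add: \<gamma>_def powr_half_sqrt)
    finally show ?thesis by auto
  qed
  ultimately show ?thesis using \<nu> r' by blast
qed

text \<open>At a boundary point off the axis \<open>\<real>e\<close> some coordinate other than the one along \<open>e\<close> is nonzero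
  and the boundary is a graph in that direction. The bump vanishes near the two points on the axis,
  which is why it is supported in \<open>[0, 1/2]\<close> rather than on a half-line.\<close>

lemma smooth_boundary_domain: "smooth_boundary \<Omega>"
  unfolding smooth_boundary_def
proof
  fix p assume p: "p \<in> frontier \<Omega>"
  note norm_p = frontier_domainD[OF p]
  show "\<exists>\<nu> r \<gamma>. norm \<nu> = 1 \<and> r > 0 \<and>
           smooth_on (ball (hyperplane_proj \<nu> p) r) (\<gamma> :: 'a \<Rightarrow> real) \<and>
           \<Omega> \<inter> ball p r = {x \<in> ball p r. x \<bullet> \<nu> > \<gamma> (hyperplane_proj \<nu> x)}"
  proof (cases "\<exists>j\<in>Basis. j \<noteq> e \<and> p \<bullet> j \<noteq> 0")
    case True
    then obtain j where j: "j \<in> Basis" "j \<noteq> e" "p \<bullet> j \<noteq> 0" by auto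
    define \<nu> where "\<nu> = - sgn (p \<bullet> j) *\<^sub>R j"
    \<comment> \<open>Projecting along \<open>j\<close> keeps the coordinate along \<open>e\<close>,
      so the bump is a function of the projection.\<close>
    have proj: "hyperplane_proj \<nu> x \<bullet> e = x \<bullet> e" for x
      using j e by (simp add: hyperplane_proj_def \<nu>_def inner_diff_left inner_not_same_Basis)
    show ?thesis
    proof (rule smooth_graph[where r = 1 and b = "\<lambda>y. \<beta> (y \<bullet> e)" and \<nu> = \<nu>])
      show "norm \<nu> = 1" "p \<bullet> \<nu> < 0"
        using j by (auto simp: \<nu>_def sgn_if)
      show "smooth_on UNIV (\<lambda>y. \<beta> (y \<bullet> e))"
        unfolding smooth_on_def
      proof
        show "Ck_on k UNIV (\<lambda>y. \<beta> (y \<bullet> e))" for k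
          by (rule Ck_on_compose[OF open_UNIV _ Ck_on_bounded_linear[OF open_UNIV
                bounded_linear_inner_left], of k UNIV]) (use smooth in \<open>auto simp: smooth_on_def\<close>)
      qed
    qed (use norm_p in \<open>auto simp: \<Omega>_def proj\<close>)
  next
    case False
    have "p = (\<Sum>i\<in>Basis. (p \<bullet> i) *\<^sub>R i)" by (simp add: euclidean_representation)
    also have "\<dots> = (\<Sum>i\<in>Basis. if i = e then (p \<bullet> e) *\<^sub>R e else 0)"
      using False by (intro sum.cong) auto
    finally have pe: "p = (p \<bullet> e) *\<^sub>R e" using e by simp
    have "norm p = \<bar>p \<bullet> e\<bar>" using e by (subst pe) simp
    then have ge1: "1 \<le> \<bar>p \<bullet> e\<bar>" using norm_frontier_domain(1)[OF p] by simp
    define \<nu> where "\<nu> = - sgn (p \<bullet> e) *\<^sub>R e"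
    show ?thesis
    \<comment> \<open>Since \<open>\<bar>p \<bullet> e\<bar> \<ge> 1\<close>, within distance 1/2 of
      \<open>p\<close> the coordinate along \<open>e\<close> avoids the support of the bump, and the
      domain is locally the unit ball.\<close>
    proof (rule smooth_graph[where r = "1/2" and b = "\<lambda>_. 0" and \<nu> = \<nu>])
      show "norm \<nu> = 1" "p \<bullet> \<nu> < 0"
        using e ge1 by (auto simp: \<nu>_def sgn_if)
      show "smooth_on UNIV (\<lambda>y::'a. 0::real)" by (simp add: smooth_on_def Ck_on_const)
      have bump0: "\<beta> (x \<bullet> e) = 0" if "x \<in> ball p (1/2)" for x
      proof (rule zero)
        have "\<bar>(p - x) \<bullet> e\<bar> < 1/2"
          using Basis_le_norm[OF e, of "p - x"] that by (simp add: dist_norm)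
        then show "x \<bullet> e \<le> 0 \<or> 1/2 \<le> x \<bullet> e" using ge1 unfolding inner_diff_left by linarith
      qed
      then show "x \<in> \<Omega> \<longleftrightarrow> (norm x)\<^sup>2 < 1 + 0" if "x \<in> ball p (1/2)" for x
        using that by (simp add: \<Omega>_def)
      show "(norm p)\<^sup>2 = 1 + 0" using norm_p bump0[of p] by simp
    qed simp
  qed
qed

text \<open>All vectors \<open>i\<close> and \<open>- i\<close> with \<open>i \<in> Basis\<close>
  lie on the frontier. Equidistance from each such pair forces the centre to be 0, hence the radius
  to be 1, but the bump adds points outside the unit ball.\<close>

lemma domain_not_ball:
  assumes "DIM('a) \<ge> 2"
  shows "\<Omega> \<noteq> ball x0 r"
proof
  assume eq: "\<Omega> = ball x0 r"
  have "r > 0" using eq ball_subset_domain by (cases "r > 0") (auto simp: ball_empty)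
  have on: "norm (x - x0) = r" if "norm x = 1" "x \<bullet> e \<le> 0 \<or> 1/2 \<le> x \<bullet> e" for x
    using unit_in_frontier[OF that] \<open>r > 0\<close> by (simp add: eq dist_norm norm_minus_commute)
  have orth: "x0 \<bullet> i = 0" if i: "i \<in> Basis" for i
  proof -
    have ie: "i \<bullet> e = (if i = e then 1 else 0)" using i e by (simp add: inner_Basis)
    have "norm (i - x0) = r" "norm (- i - x0) = r"
      using i by (auto intro!: on simp: ie)
    then have "(norm (i - x0))\<^sup>2 = (norm (- i - x0))\<^sup>2" by simp
    then show ?thesis by (simp add: power2_norm_eq_inner algebra_simps inner_commute)
  qed
  then have x0: "x0 = 0" by (auto intro: euclidean_eqI)
  then have r: "r = 1" using on[of "- e"] e by simp
  have "card (Basis - {e}) \<ge> 1" using assms e by simp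
  then have "Basis - {e} \<noteq> {}" by force
  then obtain j where j: "j \<in> Basis" "j \<noteq> e" by auto
  \<comment> \<open>A unit vector whose coordinate along \<open>e\<close> is 1/4, the middle of the
    bump; the second direction \<open>j\<close> exists because the dimension is at least 2.\<close>
  define y where "y = (1/4) *\<^sub>R e + sqrt (15/16) *\<^sub>R j"
  have "e \<bullet> e = 1" "j \<bullet> j = 1" "j \<bullet> e = 0" "e \<bullet> j = 0"
    using e j by (auto simp: inner_Basis)
  then have y: "(norm y)\<^sup>2 = 1" "y \<bullet> e = 1/4"
    by (auto simp: y_def power2_norm_eq_inner inner_add_left inner_add_right)
  have "y \<in> \<Omega>"
    using pos[of "1/4"] by (simp only: \<Omega>_def mem_Collect_eq y) simp
  moreover have "y \<notin> ball 0 1"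
    using y(1) power_less_one_iff[of "norm y" 2] by auto
  ultimately have "ball x0 r \<noteq> ball 0 1" using eq by blast
  then show False using x0 r by simp
qed

section \<open>The spherical cap opposite the bump\<close>

definition \<Gamma> :: "'a set" where
  "\<Gamma> = frontier \<Omega> \<inter> {x. x \<bullet> e < 0}"

lemma openin_cap: "openin (top_of_set (frontier \<Omega>)) \<Gamma>"
  unfolding \<Gamma>_def by (intro openin_open_Int open_Collect_less continuous_intros)

lemma cap_eq: "\<Gamma> = {x. norm x = 1 \<and> x \<bullet> e < 0}"
proof -
  have "norm x = 1" if "x \<in> frontier \<Omega>" "x \<bullet> e < 0" for x
  proof -
    have "(norm x)\<^sup>2 = 1" using frontier_domainD[OF that(1)] zero[of "x \<bullet> e"] that(2) by simp
    then show ?thesis using norm_ge_zero[of x] by (auto simp: power2_eq_1_iff)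
  qed
  then show ?thesis using unit_in_frontier by (auto simp: \<Gamma>_def)
qed

lemma cap_nonempty: "\<Gamma> \<noteq> {}"
  using e by (auto simp: cap_eq intro!: exI[of _ "- e"])

text \<open>The open hemisphere is the image of a convex open half-space under normalization, which
  is continuous there since 0 is excluded.\<close>

lemma connected_cap: "connected \<Gamma>"
proof -
  let ?H = "{x::'a. x \<bullet> e < 0}"
  have "continuous_on ?H (\<lambda>x. x /\<^sub>R norm x)"
    by (auto intro!: continuous_intros)
  moreover have "connected ?H"
    using convex_connected[OF convex_halfspace_lt[of e 0]] by (simp add: inner_commute)
  ultimately have "connected ((\<lambda>x. x /\<^sub>R norm x) ` ?H)" by (rule connected_continuous_image)
  also have "(\<lambda>x. x /\<^sub>R norm x) ` ?H = \<Gamma>"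
  proof (intro subset_antisym subsetI)
    fix y assume "y \<in> (\<lambda>x. x /\<^sub>R norm x) ` ?H"
    then obtain x where x: "x \<bullet> e < 0" "y = x /\<^sub>R norm x" by auto
    then have "x \<noteq> 0" by auto
    with x show "y \<in> \<Gamma>" by (auto simp: cap_eq divide_simps)
  next
    fix y assume "y \<in> \<Gamma>"
    then show "y \<in> (\<lambda>x. x /\<^sub>R norm x) ` ?H" by (auto simp: cap_eq intro!: image_eqI[of _ _ y])
  qed
  finally show ?thesis .
qed

end

section \<open>Radial functions\<close>

definition radial_grad :: "(real \<Rightarrow> real) \<Rightarrow> real^'n \<Rightarrow> real^'n" where
  "radial_grad p' x = (p' (norm x) / norm x) *\<^sub>R x"

text \<open>With \<open>r = norm x\<close> and \<open>P\<close> the orthogonal projection onto the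
  line of \<open>x\<close>, this is \<open>p'' r\<close> times \<open>P\<close> plus
  \<open>p' r / r\<close> times the complementary projection.\<close>

definition radial_hess :: "(real \<Rightarrow> real) \<Rightarrow> (real \<Rightarrow> real) \<Rightarrow> real^'n \<Rightarrow> real^'n^'n" where
  "radial_hess p' p'' x = (\<chi> i j. p' (norm x) / norm x * (if i = j then 1 else 0) +
     (p'' (norm x) / (norm x)\<^sup>2 - p' (norm x) / norm x ^ 3) * (x $ i * x $ j))"

lemma norm_radial_grad: "x \<noteq> 0 \<Longrightarrow> norm (radial_grad p' x) = \<bar>p' (norm x)\<bar>"
  by (simp add: radial_grad_def)

lemma GDERIV_radial:
  assumes "x \<noteq> 0" "(p has_real_derivative p' (norm x)) (at (norm x))"
  shows "GDERIV (\<lambda>x. p (norm x)) x :> radial_grad p' x"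
  using GDERIV_DERIV_compose[OF GDERIV_norm[OF assms(1)] assms(2)]
  by (simp add: radial_grad_def sgn_div_norm divide_inverse)

text \<open>Product rule for the scalar \<open>p' r / r\<close> times the identity, then compared
  with the matrix entry by entry.\<close>

lemma radial_grad_has_derivative:
  assumes "x \<noteq> 0" "(p' has_real_derivative p'' (norm x)) (at (norm x))"
  shows "(radial_grad p' has_derivative (\<lambda>h. radial_hess p' p'' x *v h)) (at x)"
proof -
  define r where "r = norm x"
  have r: "r > 0" using assms by (simp add: r_def)
  have "((\<lambda>r. p' r / r) has_real_derivative p'' r / r - p' r / r\<^sup>2) (at r)"
    using assms(2)[folded r_def] r
    by (auto intro!: derivative_eq_intros simp: power2_eq_square diff_divide_distrib)
  from GDERIV_DERIV_compose[OF GDERIV_norm[OF assms(1)] this[unfolded r_def]]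
  have "((\<lambda>x. p' (norm x) / norm x) has_derivative
      (\<lambda>h. h \<bullet> ((p'' r / r - p' r / r\<^sup>2) *\<^sub>R sgn x))) (at x)"
    by (simp add: gderiv_def r_def)
  from has_derivative_scaleR[OF this has_derivative_ident]
  have "(radial_grad p' has_derivative
      (\<lambda>h. (p' r / r) *\<^sub>R h + (h \<bullet> ((p'' r / r - p' r / r\<^sup>2) *\<^sub>R sgn x)) *\<^sub>R x)) (at x)"
    by (simp add: radial_grad_def[abs_def] r_def)
  moreover have "(p' r / r) *\<^sub>R h + (h \<bullet> ((p'' r / r - p' r / r\<^sup>2) *\<^sub>R sgn x)) *\<^sub>R x =
      radial_hess p' p'' x *v h" for h
  proof (rule vec_eq_iff[THEN iffD2], rule)
    fix i
    have "(radial_hess p' p'' x *v h) $ i =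
        (\<Sum>j\<in>UNIV. (if i = j then p' r / r * h $ j else 0) +
          (p'' r / r\<^sup>2 - p' r / r ^ 3) * x $ i * (h $ j * x $ j))"
      unfolding matrix_vector_mult_def radial_hess_def r_def
      by (auto intro!: sum.cong simp: algebra_simps)
    also have "\<dots> = p' r / r * h $ i + (p'' r / r\<^sup>2 - p' r / r ^ 3) * x $ i * (h \<bullet> x)"
      by (simp add: sum.distrib inner_vec_def flip: sum_distrib_left)
    also have "\<dots> = ((p' r / r) *\<^sub>R h + (h \<bullet> ((p'' r / r - p' r / r\<^sup>2) *\<^sub>R sgn x)) *\<^sub>R x) $ i"
      using r by (simp add: sgn_div_norm field_simps power2_eq_square power3_eq_cube flip: r_def)
    finally show "((p' r / r) *\<^sub>R h + (h \<bullet> ((p'' r / r - p' r / r\<^sup>2) *\<^sub>R sgn x)) *\<^sub>R x) $ i =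
      (radial_hess p' p'' x *v h) $ i" by simp
  qed
  ultimately show ?thesis by simp
qed

text \<open>The rank-one part has trace \<open>p'' r - p' r / r\<close>, which removes one of the
  \<open>CARD('n)\<close> copies of \<open>p' r / r\<close>.\<close>

lemma trace_radial_hess:
  fixes x :: "real^'n"
  assumes "x \<noteq> 0"
  shows "trace (radial_hess p' p'' x) =
    p'' (norm x) + (real CARD('n) - 1) * (p' (norm x) / norm x)"
proof -
  define r where "r = norm x"
  have r: "r > 0" using assms by (simp add: r_def)
  have "trace (radial_hess p' p'' x) =
      real CARD('n) * (p' r / r) + (p'' r / r\<^sup>2 - p' r / r ^ 3) * (x \<bullet> x)"
    by (simp add: trace_def radial_hess_def inner_vec_def sum.distrib r_def sum_distrib_left)
  also have "x \<bullet> x = r\<^sup>2" by (simp add: r_def power2_norm_eq_inner)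
  also have "(p'' r / r\<^sup>2 - p' r / r ^ 3) * r\<^sup>2 = p'' r - p' r / r"
    using r by (simp add: field_simps power2_eq_square power3_eq_cube)
  finally show ?thesis by (simp add: algebra_simps flip: r_def)
qed

lemma continuous_on_radial_grad:
  assumes "continuous_on UNIV p'" "0 \<notin> S"
  shows "continuous_on S (radial_grad p')"
  unfolding radial_grad_def[abs_def] using assms(2)
  by (intro continuous_intros continuous_on_compose2[OF assms(1)]) auto

lemma continuous_on_radial_hess:
  assumes "continuous_on UNIV p'" "continuous_on UNIV p''" "0 \<notin> S"
  shows "continuous_on S (radial_hess p' p'')"
  unfolding radial_hess_def[abs_def] using assms(3)
  by (intro continuous_intros continuous_on_compose2[OF assms(1)]
      continuous_on_compose2[OF assms(2)]) auto

section \<open>The radial profile\<close>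

text \<open>The closures of the two half-lines meet only at \<open>c\<close>, where values and
  derivatives agree.\<close>

lemma DERIV_glue:
  fixes f g :: "real \<Rightarrow> real"
  assumes "\<And>x. (f has_real_derivative f' x) (at x)" "\<And>x. (g has_real_derivative g' x) (at x)"
    and "f c = g c" "f' c = g' c"
  shows "((\<lambda>x. if x \<le> c then f x else g x) has_real_derivative (if x \<le> c then f' x else g' x)) (at x)"
proof -
  have "((\<lambda>x. if x \<in> {..c} then f x else g x) has_derivative
      (if x \<in> {..c} then (*) (f' x) else (*) (g' x))) (at x within {..c} \<union> {c<..})"
    by (rule has_derivative_If_within_closures)
      (use assms in \<open>auto simp: has_field_derivative_def intro: has_derivative_at_withinI\<close>)
  moreover have "{..c} \<union> {c<..} = UNIV" by auto
  ultimately show ?thesis by (simp add: has_field_derivative_def if_distrib[of "(*)"])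
qed

text \<open>The decay rate and the coefficients are determined by matching the affine part up to second
  order at \<open>r = 2\<close>.\<close>

definition profile :: "real \<Rightarrow> real" where
  "profile r = (if r \<le> 2 then (3 - r) / 2 else exp (- 2 * (r - 2)) * (r - 1) / 2)"

definition profile' :: "real \<Rightarrow> real" where
  "profile' r = (if r \<le> 2 then - 1 / 2 else - exp (- 2 * (r - 2)) * (r - 3 / 2))"

definition profile'' :: "real \<Rightarrow> real" where
  "profile'' r = (if r \<le> 2 then 0 else exp (- 2 * (r - 2)) * (2 * (r - 2)))"

lemma profile_deriv: "(profile has_real_derivative profile' r) (at r)"
  unfolding profile_def[abs_def] profile'_def
  by (rule DERIV_glue) (auto intro!: derivative_eq_intros simp: field_simps)

lemma profile'_deriv: "(profile' has_real_derivative profile'' r) (at r)"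
  unfolding profile'_def[abs_def] profile''_def
  by (rule DERIV_glue) (auto intro!: derivative_eq_intros simp: algebra_simps)

lemma continuous_on_profile: "continuous_on S profile" "continuous_on S profile'"
  using profile_deriv profile'_deriv
  by (auto intro!: continuous_at_imp_continuous_on DERIV_isCont)

lemma continuous_on_profile'': "continuous_on S profile''"
proof -
  \<comment> \<open>Clamping the argument at 2 merges both branches into one continuous formula, as
    the outer branch vanishes at 2.\<close>
  have "profile'' = (\<lambda>r. exp (- 2 * (max r 2 - 2)) * (2 * (max r 2 - 2)))"
    by (auto simp: profile''_def max_def)
  then show ?thesis by (elim ssubst) (intro continuous_intros)
qed

lemma profile_tendsto: "(profile \<longlongrightarrow> 0) at_top" "(profile' \<longlongrightarrow> 0) at_top"
proof -
  have lim: "((\<lambda>r::real. exp (- 2 * (r - 2)) * (r + c)) \<longlongrightarrow> 0) at_top" for c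
  proof -
    \<comment> \<open>The factor \<open>exp (- 2 * r)\<close> is split into two copies of
      \<open>1 / exp r\<close>, so that the limit of \<open>r ^ k / exp r\<close> applies with
      \<open>k\<close> equal to 0 and 1.\<close>
    have "((\<lambda>r::real. exp 4 * (r ^ 1 / exp r + c * (r ^ 0 / exp r)) * (r ^ 0 / exp r))
        \<longlongrightarrow> exp 4 * (0 + c * 0) * 0) at_top"
      by (intro tendsto_intros tendsto_power_div_exp_0)
    moreover have "exp 4 * (r ^ 1 / exp r + c * (r ^ 0 / exp r)) * (r ^ 0 / exp r) =
        exp (- 2 * (r - 2)) * (r + c)" for r :: real
    proof -
      have "exp (- 2 * (r - 2)) = exp (4 - r - r)" by simp
      also have "\<dots> = exp 4 / exp r / exp r" by (simp only: exp_diff)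
      finally show ?thesis by (simp add: field_simps)
    qed
    ultimately show ?thesis by simp
  qed
  have ev: "eventually (\<lambda>r. exp (- 2 * (r - 2)) * (r + - 1) / 2 = profile r) at_top"
    "eventually (\<lambda>r. - (exp (- 2 * (r - 2)) * (r + - 3 / 2)) = profile' r) at_top"
    using eventually_gt_at_top[of 2]
    by (eventually_elim, simp add: profile_def profile'_def)+
  show "(profile \<longlongrightarrow> 0) at_top"
    using tendsto_divide[OF lim[of "- 1"] tendsto_const, of 2] by (intro Lim_transform_eventually[OF _ ev(1)]) simp
  show "(profile' \<longlongrightarrow> 0) at_top"
    using tendsto_minus[OF lim[of "- 3 / 2"]] by (intro Lim_transform_eventually[OF _ ev(2)]) simp
qed

section \<open>The nonlinearity as a Lipschitz function of the solution\<close>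

text \<open>The bound on \<open>g'\<close> makes both \<open>L * p + g\<close> and
  \<open>L * p - g\<close> nonincreasing.\<close>

lemma DERIV_dominated_imp_diff_le:
  fixes p g :: "real \<Rightarrow> real"
  assumes "a \<le> b" "\<And>x. a \<le> x \<Longrightarrow> x \<le> b \<Longrightarrow> (p has_real_derivative p' x) (at x)"
    and "\<And>x. a \<le> x \<Longrightarrow> x \<le> b \<Longrightarrow> (g has_real_derivative g' x) (at x)"
    and "\<And>x. a \<le> x \<Longrightarrow> x \<le> b \<Longrightarrow> \<bar>g' x\<bar> \<le> - L * p' x"
  shows "\<bar>g a - g b\<bar> \<le> L * (p a - p b)"
proof -
  have "L * p b + g b \<le> L * p a + g a"
  proof (rule DERIV_nonpos_imp_nonincreasing[OF assms(1)], intro exI conjI)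
    fix x assume x: "a \<le> x" "x \<le> b"
    show "((\<lambda>x. L * p x + g x) has_real_derivative L * p' x + g' x) (at x)"
      using x by (intro DERIV_add DERIV_cmult assms(2,3))
    show "L * p' x + g' x \<le> 0" using assms(4)[OF x] by (simp add: abs_le_iff)
  qed
  moreover have "L * p b - g b \<le> L * p a - g a"
  proof (rule DERIV_nonpos_imp_nonincreasing[OF assms(1)], intro exI conjI)
    fix x assume x: "a \<le> x" "x \<le> b"
    show "((\<lambda>x. L * p x - g x) has_real_derivative L * p' x - g' x) (at x)"
      using x by (intro DERIV_diff DERIV_cmult assms(2,3))
    show "L * p' x - g' x \<le> 0" using assms(4)[OF x] by (simp add: abs_le_iff)
  qed
  ultimately show ?thesis by (simp add: algebra_simps abs_le_iff)
qed

text \<open>For \<open>N\<close> one less than the dimension, minus the Laplacian of the radial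
  function with this profile, at radius \<open>r\<close>.\<close>

definition source :: "real \<Rightarrow> real \<Rightarrow> real" where
  "source N r = - (profile'' r + N * (profile' r / r))"

text \<open>Derivatives are compared separately on \<open>[1, 2]\<close> and beyond 2, where the
  formulas differ, and the estimates are joined at 2. Since the profile decreases, the right side is
  nonnegative without an absolute value.\<close>

lemma source_diff_le:
  assumes "N \<ge> 0" "1 \<le> r" "r \<le> s"
  shows "\<bar>source N r - source N s\<bar> \<le> (4 + 3 * N) * (profile r - profile s)"
proof -
  have inner: "\<bar>source N r - source N s\<bar> \<le> (4 + 3 * N) * (profile r - profile s)"
    if "1 \<le> r" "r \<le> s" "s \<le> 2" for r s
  proof -
    \<comment> \<open>On the affine part the second derivative vanishes and the source reduces to
      \<open>N / (2 * r)\<close>.\<close>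
    have "\<bar>N / (2 * r) - N / (2 * s)\<bar> \<le> (4 + 3 * N) * ((3 - r) / 2 - (3 - s) / 2)"
    proof (rule DERIV_dominated_imp_diff_le[OF \<open>r \<le> s\<close>])
      fix x assume x: "r \<le> x" "x \<le> s"
      with that have "x \<ge> 1" by simp
      then show "((\<lambda>x. N / (2 * x)) has_real_derivative - N / (2 * x\<^sup>2)) (at x)"
        by (auto intro!: derivative_eq_intros simp: power2_eq_square field_simps)
      show "((\<lambda>x. (3 - x) / 2) has_real_derivative - 1 / 2) (at x)"
        by (auto intro!: derivative_eq_intros)
      have "x\<^sup>2 \<ge> 1" using \<open>x \<ge> 1\<close> by simp
      then have "N / (2 * x\<^sup>2) \<le> N / 1" using \<open>N \<ge> 0\<close> by (intro divide_left_mono) auto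
      moreover have "\<bar>- N / (2 * x\<^sup>2)\<bar> = N / (2 * x\<^sup>2)" using \<open>N \<ge> 0\<close> by simp
      moreover have "- (4 + 3 * N) * (- 1 / 2) = 2 + 3 * N / 2" by (simp add: field_simps)
      ultimately show "\<bar>- N / (2 * x\<^sup>2)\<bar> \<le> - (4 + 3 * N) * (- 1 / 2)"
        using \<open>N \<ge> 0\<close> by linarith
    qed
    then show ?thesis using that by (simp add: source_def profile_def profile'_def profile''_def)
  qed
  have outer: "\<bar>source N r - source N s\<bar> \<le> (4 + 3 * N) * (profile r - profile s)"
    if "2 \<le> r" "r \<le> s" for r s
  proof -
    define E where "E x = exp (- 2 * (x - 2))" for x :: real
    define p where "p x = E x * (x - 1) / 2" for x
    define g where "g x = E x * (N * (x - 3/2) / x - 2 * (x - 2))" for x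
    have E': "(E has_real_derivative - 2 * E x) (at x)" for x
      unfolding E_def[abs_def] by (auto intro!: derivative_eq_intros)
    have "\<bar>g r - g s\<bar> \<le> (4 + 3 * N) * (p r - p s)"
    proof (rule DERIV_dominated_imp_diff_le[OF \<open>r \<le> s\<close>])
      fix x assume "r \<le> x" "x \<le> s"
      with that have x: "x \<ge> 2" by simp
      show "(p has_real_derivative - E x * (x - 3/2)) (at x)"
        unfolding p_def[abs_def] by (auto intro!: derivative_eq_intros E' simp: field_simps)
      let ?A = "- 2 * (N * (x - 3/2) / x - 2 * (x - 2)) + N * (3/2 / x\<^sup>2) - 2"
      show "(g has_real_derivative E x * ?A) (at x)"
        unfolding g_def[abs_def] using x
        by (auto intro!: derivative_eq_intros E' simp: power2_eq_square field_simps)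
      have 1: "\<bar>N * (x - 3/2) / x\<bar> \<le> N * (x - 3/2)"
      proof -
        define c where "c = N * (x - 3/2)"
        have "c \<ge> 0" using x \<open>N \<ge> 0\<close> by (simp add: c_def)
        then have "c / x \<le> c / 1" using x by (intro divide_left_mono) auto
        then show ?thesis using \<open>c \<ge> 0\<close> x by (simp flip: c_def)
      qed
      have "3/2 / x\<^sup>2 \<le> x - 3/2"
      proof -
        have "2 * 2 \<le> x * x" using x by (intro mult_mono) auto
        then have "3/2 / x\<^sup>2 \<le> 3/2 / 4" by (intro divide_left_mono) (auto simp: power2_eq_square)
        then show ?thesis using x by simp
      qed
      from mult_left_mono[OF this \<open>N \<ge> 0\<close>]
      have 2: "\<bar>N * (3/2 / x\<^sup>2)\<bar> \<le> N * (x - 3/2)"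
        using \<open>N \<ge> 0\<close> by (subst abs_of_nonneg) auto
      \<comment> \<open>The constant \<open>4 + 3 * N\<close> comes from here: \<open>P\<close> and
        \<open>R\<close> contribute \<open>3 * c\<close>, and
        \<open>\<bar>4 * x - 10\<bar> \<le> 4 * (x - 3/2)\<close> for \<open>x \<ge> 2\<close>, with
        equality at 2. The common factor \<open>x - 3/2\<close> is that of
        \<open>profile'\<close>.\<close>
      have "\<bar>- 2 * (P - 2 * (x - 2)) + R - 2\<bar> \<le> 4 * x - 6 + 3 * c"
        if "\<bar>P\<bar> \<le> c" "\<bar>R\<bar> \<le> c" for P R c
        using that x by (simp add: abs_le_iff)
      from this[OF 1 2] have "\<bar>?A\<bar> \<le> (4 + 3 * N) * (x - 3/2)"
        by (simp only: distrib_right mult.assoc right_diff_distrib)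
      then have "E x * \<bar>?A\<bar> \<le> E x * ((4 + 3 * N) * (x - 3/2))"
        by (intro mult_left_mono) (auto simp: E_def)
      moreover have "\<bar>E x * ?A\<bar> = E x * \<bar>?A\<bar>" by (simp only: abs_mult) (simp add: E_def)
      moreover have "- (4 + 3 * N) * (- E x * (x - 3/2)) = E x * ((4 + 3 * N) * (x - 3/2))" by algebra
      ultimately show "\<bar>E x * ?A\<bar> \<le> - (4 + 3 * N) * (- E x * (x - 3/2))" by (simp only:)
    qed
    moreover have "profile x = p x" "source N x = g x" if "x \<ge> 2" for x
      using that
      by (auto simp: source_def profile_def profile'_def profile''_def p_def g_def E_def field_simps)
    ultimately show ?thesis using that by simp
  qed
  consider "s \<le> 2" | "2 \<le> r" | "r \<le> 2" "2 \<le> s" by linarith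
  then show ?thesis
  proof cases
    case 3
    have "\<bar>source N r - source N s\<bar> \<le> \<bar>source N r - source N 2\<bar> + \<bar>source N 2 - source N s\<bar>"
      by linarith
    also have "\<dots> \<le> (4 + 3 * N) * (profile r - profile 2) + (4 + 3 * N) * (profile 2 - profile s)"
      using 3 assms by (intro add_mono inner outer) auto
    finally show ?thesis by (simp add: algebra_simps)
  qed (use assms inner outer in auto)
qed

text \<open>The hypothesis makes \<open>g\<close> a well-defined Lipschitz function of the value of
  \<open>p\<close>, which is then extended to the whole line. No inverse of \<open>p\<close> has to
  be constructed.\<close>

lemma factor_lipschitz:
  fixes p g :: "'a \<Rightarrow> real"
  assumes "S \<noteq> {}" "L \<ge> 0" "\<And>x y. x \<in> S \<Longrightarrow> y \<in> S \<Longrightarrow> \<bar>g x - g y\<bar> \<le> L * \<bar>p x - p y\<bar>"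
  obtains f where "L-lipschitz_on UNIV f" "\<And>x. x \<in> S \<Longrightarrow> f (p x) = g x"
proof
  \<comment> \<open>McShane's extension formula\<close>
  define F where "F t = (\<lambda>x. g x + L * \<bar>t - p x\<bar>) ` S" for t
  define f where "f t = Inf (F t)" for t
  \<comment> \<open>This bounds the infimum from below and, at \<open>t = p y\<close>, shows that
    the extension does not drop under \<open>g y\<close>.\<close>
  have lower: "g y - L * \<bar>t - p y\<bar> \<le> g x + L * \<bar>t - p x\<bar>" if "x \<in> S" "y \<in> S" for x y t
  proof -
    have "g y - g x \<le> L * \<bar>p y - p x\<bar>" using assms(3)[OF that(2,1)] by linarith
    also have "\<dots> \<le> L * (\<bar>t - p x\<bar> + \<bar>t - p y\<bar>)" using assms(2) by (intro mult_left_mono) auto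
    finally show ?thesis by (simp add: algebra_simps)
  qed
  have ne: "F t \<noteq> {}" for t using assms(1) by (simp add: F_def)
  have bdd: "bdd_below (F t)" for t
    using assms(1) lower unfolding F_def bdd_below_def by blast
  have le: "f s \<le> f t + L * \<bar>s - t\<bar>" for s t
  proof -
    have "f s - L * \<bar>s - t\<bar> \<le> z" if z: "z \<in> F t" for z
    proof -
      obtain x where x: "x \<in> S" "z = g x + L * \<bar>t - p x\<bar>" using z by (auto simp: F_def)
      have "f s \<le> g x + L * \<bar>s - p x\<bar>"
        unfolding f_def using x(1) by (intro cInf_lower bdd) (auto simp: F_def)
      also have "L * \<bar>s - p x\<bar> \<le> L * (\<bar>t - p x\<bar> + \<bar>s - t\<bar>)"
        using assms(2) by (intro mult_left_mono) auto
      finally show ?thesis using x by (simp add: algebra_simps)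
    qed
    then have "f s - L * \<bar>s - t\<bar> \<le> f t"
      unfolding f_def[of t] by (intro cInf_greatest ne)
    then show ?thesis by simp
  qed
  show "L-lipschitz_on UNIV f"
  proof (rule lipschitz_onI)
    show "dist (f s) (f t) \<le> L * dist s t" for s t
      using le[of s t] le[of t s] by (simp add: dist_real_def abs_minus_commute)
  qed (rule assms(2))
  show "f (p x) = g x" if "x \<in> S" for x
  proof (rule antisym)
    show "f (p x) \<le> g x"
      unfolding f_def using that by (intro cInf_lower bdd) (force simp: F_def)
    show "g x \<le> f (p x)"
      unfolding f_def using lower[OF _ that, of _ "p x"] by (intro cInf_greatest ne) (auto simp: F_def)
  qed
qed

section \<open>Existence of the domain, the cap and the exterior solution\<close>

theorem theorem3p3:
  assumes "CARD('n::finite) \<ge> 2"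
  shows "\<exists>(f :: real \<Rightarrow> real) (\<Omega> :: (real^'n) set) (\<Gamma> :: (real^'n) set)
           (u :: real^'n \<Rightarrow> real) (Du :: real^'n \<Rightarrow> real^'n) (D2u :: real^'n \<Rightarrow> real^'n^'n).
      (\<exists>L. L-lipschitz_on UNIV f) \<and>
      open \<Omega> \<and> bounded \<Omega> \<and> \<Omega> \<noteq> {} \<and> connected \<Omega> \<and> simply_connected \<Omega> \<and>
      (\<forall>x0 r. \<Omega> \<noteq> ball x0 r) \<and>
      smooth_boundary \<Omega> \<and>
      \<Gamma> \<subseteq> frontier \<Omega> \<and> \<Gamma> \<noteq> {} \<and> connected \<Gamma> \<and>
      openin (top_of_set (frontier \<Omega>)) \<Gamma> \<and>
      (\<exists>x0 r. r > 0 \<and> \<Gamma> \<subseteq> sphere x0 r) \<and>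
      C2_outside \<Omega> u Du D2u \<and>
      (\<forall>x \<in> - closure \<Omega>. - trace (D2u x) = f (u x)) \<and>
      (\<forall>x \<in> frontier \<Omega>. norm (Du x) = 1 / 2) \<and>
      (\<forall>x \<in> \<Gamma>. u x = 1) \<and>
      (u \<longlongrightarrow> 0) at_infinity \<and>
      ((\<lambda>x. norm (Du x)) \<longlongrightarrow> 0) at_infinity"
proof -
  \<comment> \<open>Any coordinate direction serves; \<open>undefined\<close> picks an arbitrary
    index.\<close>
  define e :: "real^'n" where "e = axis undefined 1"
  obtain \<beta> :: "real \<Rightarrow> real" where \<beta>: "smooth_on UNIV \<beta>" "\<And>t. 0 \<le> \<beta> t"
    "\<And>t. t \<le> 0 \<or> 1/2 \<le> t \<Longrightarrow> \<beta> t = 0" "\<And>t. 0 < t \<Longrightarrow> t < 1/2 \<Longrightarrow> 0 < \<beta> t"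
    "1-lipschitz_on UNIV \<beta>"
    by (rule bump_exists) blast
  interpret bumped_ball \<beta> e
    by unfold_locales (use \<beta> in \<open>auto simp: e_def axis_in_Basis_iff\<close>)
  define N where "N = real CARD('n) - 1"
  have N: "N \<ge> 0" using assms by (simp add: N_def)
  have le: "\<bar>source N r - source N s\<bar> \<le> (4 + 3 * N) * \<bar>profile r - profile s\<bar>"
    if rs: "r \<in> {1..}" "s \<in> {1..}" for r s
  proof -
    have "\<bar>source N r - source N s\<bar> \<le> (4 + 3 * N) * (profile r - profile s) \<or>
        \<bar>source N s - source N r\<bar> \<le> (4 + 3 * N) * (profile s - profile r)"
      using source_diff_le[OF N, of r s] source_diff_le[OF N, of s r] rs by fastforce
    moreover have "(4 + 3 * N) * (profile r - profile s) \<le> (4 + 3 * N) * \<bar>profile r - profile s\<bar>"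
      "(4 + 3 * N) * (profile s - profile r) \<le> (4 + 3 * N) * \<bar>profile r - profile s\<bar>"
      using N by (auto intro!: mult_left_mono)
    ultimately show ?thesis by linarith
  qed
  \<comment> \<open>Points outside the domain have norm at least 1, so prescribing \<open>f\<close>
    on the profile values of these radii settles the equation.\<close>
  obtain f where f: "(4 + 3 * N)-lipschitz_on UNIV f"
    "\<And>r. r \<in> {1..} \<Longrightarrow> f (profile r) = source N r"
    using factor_lipschitz[of "{1..}" "4 + 3 * N" "source N" profile] le N by auto
  define u :: "real^'n \<Rightarrow> real" where "u x = profile (norm x)" for x
  define Du :: "real^'n \<Rightarrow> real^'n" where "Du = radial_grad profile'"
  define D2u :: "real^'n \<Rightarrow> real^'n^'n" where "D2u = radial_hess profile' profile''"
  have outside: "norm x \<ge> 1" "x \<noteq> 0" if "x \<in> - closure \<Omega>" for x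
  proof -
    show "norm x \<ge> 1" using norm_ge_outside_domain[of x] that closure_subset[of \<Omega>] by blast
    then show "x \<noteq> 0" by auto
  qed
  have zero_in: "0 \<notin> - \<Omega>" using ball_subset_domain by auto
  have C2: "C2_outside \<Omega> u Du D2u"
    unfolding C2_outside_def
  proof (intro conjI ballI)
    show "continuous_on (- \<Omega>) u"
      unfolding u_def[abs_def]
      by (rule continuous_on_compose2[OF continuous_on_profile(1)[of UNIV]])
        (auto intro: continuous_intros)
    show "continuous_on (- \<Omega>) Du" "continuous_on (- \<Omega>) D2u"
      unfolding Du_def D2u_def
      by (intro continuous_on_radial_grad continuous_on_radial_hess continuous_on_profile
          continuous_on_profile'' zero_in)+
    fix x assume "x \<in> - closure \<Omega>"
    then have x: "x \<noteq> 0" by (rule outside)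
    show "GDERIV u x :> Du x"
      unfolding u_def[abs_def] Du_def by (rule GDERIV_radial[where p' = profile', OF x profile_deriv])
    show "(Du has_derivative (\<lambda>h. D2u x *v h)) (at x)"
      unfolding Du_def D2u_def by (rule radial_grad_has_derivative[where p'' = profile'', OF x profile'_deriv])
  qed
  have pde: "- trace (D2u x) = f (u x)" if "x \<in> - closure \<Omega>" for x
    using outside[OF that] by (simp add: D2u_def trace_radial_hess u_def f(2) source_def N_def)
  \<comment> \<open>The boundary lies in the annulus where \<open>profile'\<close> is constantly
    -1/2.\<close>
  have grad: "norm (Du x) = 1 / 2" if "x \<in> frontier \<Omega>" for x
    using norm_frontier_domain[OF that]
    by (auto simp: Du_def norm_radial_grad profile'_def simp flip: norm_le_zero_iff)
  have cap: "u x = 1" if "x \<in> \<Gamma>" for x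
    using that by (simp add: cap_eq u_def profile_def)
  have lim: "(u \<longlongrightarrow> 0) at_infinity"
    unfolding u_def[abs_def] by (rule filterlim_compose[OF profile_tendsto(1) filterlim_norm_at_top])
  have grad_lim: "((\<lambda>x. norm (Du x)) \<longlongrightarrow> 0) at_infinity"
  proof (rule Lim_transform_eventually)
    show "((\<lambda>x::real^'n. \<bar>profile' (norm x)\<bar>) \<longlongrightarrow> 0) at_infinity"
      using tendsto_rabs_zero[OF profile_tendsto(2)]
      by (rule filterlim_compose[OF _ filterlim_norm_at_top])
    show "\<forall>\<^sub>F x in at_infinity. \<bar>profile' (norm x)\<bar> = norm (Du x)"
      unfolding eventually_at_infinity
      by (intro exI[of _ 1] allI impI) (auto simp: Du_def norm_radial_grad simp flip: norm_le_zero_iff)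
  qed
  have sphere: "\<exists>x0 r. r > 0 \<and> \<Gamma> \<subseteq> sphere x0 r"
    by (intro exI[of _ 0] exI[of _ 1]) (auto simp: cap_eq)
  have sub: "\<Gamma> \<subseteq> frontier \<Omega>" by (auto simp: \<Gamma>_def)
  have ne: "\<Omega> \<noteq> {}" using ball_subset_domain by auto
  have not_ball: "\<forall>x0 r. \<Omega> \<noteq> ball x0 r" using domain_not_ball assms by simp
  show ?thesis
    by (rule exI[of _ f], rule exI[of _ \<Omega>], rule exI[of _ \<Gamma>], rule exI[of _ u], rule exI[of _ Du],
        rule exI[of _ D2u])
      (intro conjI ballI exI[of _ "4 + 3 * N"] f(1) open_domain bounded_domain ne
        starlike_imp_connected[OF starlike_domain] starlike_imp_simply_connected[OF starlike_domain]
        not_ball smooth_boundary_domain sub cap_nonempty connected_cap openin_cap sphere C2 pde grad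
        cap lim grad_lim)
qed

end
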